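(* Let $G$ be a graph with minimum degree $\delta\geq 3$. If the total domination polynomial $D_t(G,x)$ has exactly three distinct roots in $\mathbb{C}$, then its set of roots $Z(D_t(G,x))$ satisfies $$Z(D_t(G,x))\subseteq \left\{0,\ -2+\sqrt{2}\,i,\ -2-\sqrt{2}\,i,\ \frac{-3+\sqrt{3}\,i}{2},\ \frac{-3-\sqrt{3}\,i}{2}\right\}.$$
   Context: All graphs are finite and simple. A set $D\subseteq V$ is a total dominating set of a graph $G=(V,E)$ if every vertex of $V$ (including those in $D$) is adjacent to some vertex of $D$. Let $d_t(G,i)$ be the number of total dominating sets of $G$ of cardinality $i$. The total domination polynomial of a graph $G$ of order $n$ is $D_t(G,x)=\sum_{i=1}^{n} d_t(G,i)x^i$. $Z(D_t(G,x))$ denotes the set of complex roots of $D_t(G,x)$; here $i$ in the displayed roots is the imaginary unit. *)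

theory Defs
  imports
    Complex_Main
    "HOL-Computational_Algebra.Polynomial"
    "Graph_Theory.Pair_Digraph"
begin

text \<open>
  A finite simple graph is a \<^locale>\<open>pair_graph\<close>: a finite vertex set \<^const>\<open>pverts\<close> together with
  a symmetric irreflexive adjacency relation \<^const>\<open>parcs\<close> on it. An undirected edge is a
  pair of opposite arcs, so the degree of a vertex is its out-degree.
\<close>

text \<open>Meaningful only for a graph with at least one vertex (\<^const>\<open>Min\<close> of the empty set is unspecified).\<close>

definition min_degree :: "'a pair_pre_digraph \<Rightarrow> nat" where
  "min_degree G = Min (out_degree (with_proj G) ` pverts G)"

definition total_dominating_set :: "'a pair_pre_digraph \<Rightarrow> 'a set \<Rightarrow> bool" where
  "total_dominating_set G D \<longleftrightarrow>
     D \<subseteq> pverts G \<and> (\<forall>v\<in>pverts G. \<exists>u\<in>D. (v, u) \<in> parcs G)"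

definition num_total_dominating_sets :: "'a pair_pre_digraph \<Rightarrow> nat \<Rightarrow> nat" where
  "num_total_dominating_sets G i = card {D. total_dominating_set G D \<and> card D = i}"

definition total_domination_poly :: "'a pair_pre_digraph \<Rightarrow> complex poly" where
  "total_domination_poly G =
     (\<Sum>i = 1..card (pverts G). monom (of_nat (num_total_dominating_sets G i)) i)"

definition complex_roots :: "complex poly \<Rightarrow> complex set" where
  "complex_roots p = {z. poly p z = 0}"

end

theory Submission
  imports Defs "HOL-Computational_Algebra.Fundamental_Theorem_Algebra"
begin

text \<open>
  Let \<open>n\<close> be the order of \<open>G\<close> and \<open>P = D\<^sub>t(G, x)\<close>. A vertex set fails to be total dominating
  only if its complement contains some open neighbourhood, so every set that misses at most two
  vertices is total dominating when \<open>\<delta> \<ge> 3\<close>. Hence \<open>P = x\<^sup>n + n x\<^sup>n\<^sup>-\<^sup>1 + (n choose 2) x\<^sup>n\<^sup>-\<^sup>2 + \<dots>\<close>, and by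
  Newton's identities the roots, counted with multiplicity, have sum \<open>-n\<close> and sum of squares
  \<open>n\<close>.

  Let the roots be \<open>0\<close>, \<open>a\<close>, \<open>b\<close>, and let \<open>m\<close> be the multiplicity of \<open>0\<close>. If \<open>a\<close> and \<open>b\<close> were
  real, the Cauchy--Schwarz inequality for the \<open>n - m\<close> nonzero roots would give
  \<open>n\<^sup>2 \<le> (n - m) n\<close>, which contradicts \<open>m > 0\<close>. Since \<open>P\<close> is real, \<open>b\<close> is then the conjugate of
  \<open>a\<close>, with the same multiplicity \<open>k\<close>. With \<open>s = n / k\<close> the power sums read \<open>a + b = -s\<close> and
  \<open>a\<^sup>2 + b\<^sup>2 = s\<close>, so \<open>a\<close> and \<open>b\<close> are the roots of \<open>x\<^sup>2 + s x + s (s - 1) / 2\<close>. The lowest nonzero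
  coefficient of \<open>P\<close> is \<open>(a b)\<^sup>k\<close>; it is an integer, so the rational number
  \<open>a b = s (s - 1) / 2\<close> is an algebraic integer and therefore an integer, and then \<open>s\<close> is an
  integer for the same reason.

  It remains to bound \<open>s\<close>. From \<open>n = m + 2 k\<close> and \<open>m > 0\<close> follows \<open>s > 2\<close>. The multiplicity \<open>m\<close>
  is at most the size of any total dominating set, that is, of any set that meets all open
  neighbourhoods. These are \<open>n\<close> sets with at least three elements each, and a greedy choice meets
  them all with fewer than \<open>3 n / 5\<close> vertices
  (lemma \<open>small_total_dominating_set\<close>). So \<open>m / n = (s - 2) / s < 3 / 5\<close>, which means
  \<open>s < 5\<close>. The values \<open>s = 3\<close> and \<open>s = 4\<close> give the four nonreal numbers of the theorem.
\<close>

section \<open>Power sums of the roots\<close>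

text \<open>
  If \<open>p = 1 + c\<^sub>1 x + c\<^sub>2 x\<^sup>2 + \<dots>\<close>, then \<open>log p = c\<^sub>1 x - (c\<^sub>1\<^sup>2 - 2 c\<^sub>2) x\<^sup>2 / 2 + \<dots>\<close>. This is why \<open>c\<^sub>1\<close> and
  \<open>c\<^sub>1\<^sup>2 - 2 c\<^sub>2\<close> turn products into sums; for \<open>p = 1 - z x\<close> they are \<open>-z\<close> and \<open>z\<^sup>2\<close>.
\<close>
lemma low_coeffs_mult:
  fixes p q :: "'a :: comm_ring_1 poly"
  assumes "coeff p 0 = 1" "coeff q 0 = 1"
  shows "coeff (p * q) 0 = 1"
    and "coeff (p * q) 1 = coeff p 1 + coeff q 1"
    and "(coeff (p * q) 1)\<^sup>2 - 2 * coeff (p * q) 2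
         = ((coeff p 1)\<^sup>2 - 2 * coeff p 2) + ((coeff q 1)\<^sup>2 - 2 * coeff q 2)"
proof -
  show "coeff (p * q) 0 = 1"
    by (simp add: coeff_mult_0 assms)
  show c1: "coeff (p * q) 1 = coeff p 1 + coeff q 1"
    by (simp add: coeff_mult assms)
  have c2: "coeff (p * q) 2 = coeff q 2 + coeff p 1 * coeff q 1 + coeff p 2"
    by (simp add: coeff_mult assms numeral_2_eq_2)
  show "(coeff (p * q) 1)\<^sup>2 - 2 * coeff (p * q) 2
         = ((coeff p 1)\<^sup>2 - 2 * coeff p 2) + ((coeff q 1)\<^sup>2 - 2 * coeff q 2)"
    unfolding c1 c2 by (simp add: power2_eq_square algebra_simps)
qed

lemma low_coeffs_power:
  fixes p :: "'a :: comm_ring_1 poly"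
  assumes "coeff p 0 = 1"
  shows "coeff (p ^ k) 0 = 1 \<and> coeff (p ^ k) 1 = of_nat k * coeff p 1 \<and>
    (coeff (p ^ k) 1)\<^sup>2 - 2 * coeff (p ^ k) 2 = of_nat k * ((coeff p 1)\<^sup>2 - 2 * coeff p 2)"
proof (induction k)
  case (Suc k)
  have "coeff (p ^ k) 0 = 1" using Suc.IH by blast
  note mult = low_coeffs_mult[OF assms this, folded power_Suc]
  from Suc.IH have IH: "coeff (p ^ k) 1 = of_nat k * coeff p 1"
    "(coeff (p ^ k) 1)\<^sup>2 - 2 * coeff (p ^ k) 2 = of_nat k * ((coeff p 1)\<^sup>2 - 2 * coeff p 2)"
    by blast+
  show ?case
    unfolding mult(3) IH(2) unfolding mult(1,2) IH(1)
    by (simp only: of_nat_Suc distrib_right mult_1 simp_thms)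
qed simp

lemma low_coeffs_prod_linear:
  fixes k :: "'a :: comm_ring_1 \<Rightarrow> nat"
  assumes "finite A"
  defines "q \<equiv> \<lambda>A. \<Prod>z\<in>A. [:1, - z:] ^ k z"
  shows "coeff (q A) 0 = 1 \<and> coeff (q A) 1 = - (\<Sum>z\<in>A. of_nat (k z) * z) \<and>
    (coeff (q A) 1)\<^sup>2 - 2 * coeff (q A) 2 = (\<Sum>z\<in>A. of_nat (k z) * z\<^sup>2)"
  using assms(1)
proof (induction A rule: finite_induct)
  case empty
  then show ?case by (simp add: q_def)
next
  case (insert z A)
  have q: "q (insert z A) = [:1, - z:] ^ k z * q A"
    using insert by (simp add: q_def)
  have lin: "coeff [:1, - z:] 0 = 1" by simp
  note power = low_coeffs_power[OF lin, of "k z"]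
  have "coeff ([:1, - z:] ^ k z) 0 = 1" "coeff (q A) 0 = 1"
    using power insert.IH by blast+
  note mult = low_coeffs_mult[OF this, folded q]
  have "coeff [:1, - z:] 2 = 0"
    by (simp add: numeral_2_eq_2)
  then have pow: "coeff ([:1, - z:] ^ k z) 1 = - (of_nat (k z) * z)"
    "(coeff ([:1, - z:] ^ k z) 1)\<^sup>2 - 2 * coeff ([:1, - z:] ^ k z) 2 = of_nat (k z) * z\<^sup>2"
    using conjunct1[OF conjunct2[OF power]] conjunct2[OF conjunct2[OF power]] by simp_all
  from insert.IH have IH: "coeff (q A) 1 = - (\<Sum>z\<in>A. of_nat (k z) * z)"
    "(coeff (q A) 1)\<^sup>2 - 2 * coeff (q A) 2 = (\<Sum>z\<in>A. of_nat (k z) * z\<^sup>2)"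
    by blast+
  show ?case
    unfolding mult(3) pow(2) IH(2) unfolding mult(1,2) pow(1) IH(1)
    using insert.hyps by simp
qed

text \<open>
  The top coefficients of a monic polynomial are the bottom coefficients of its reflection, whose
  linear factors \<open>1 - z x\<close> have constant term 1.
\<close>
lemma root_power_sums:
  fixes p :: "complex poly"
  assumes monic: "lead_coeff p = 1" and deg: "degree p \<ge> 2"
  shows "(\<Sum>z | poly p z = 0. of_nat (order z p) * z) = - coeff p (degree p - 1)"
    and "(\<Sum>z | poly p z = 0. of_nat (order z p) * z\<^sup>2)
         = (coeff p (degree p - 1))\<^sup>2 - 2 * coeff p (degree p - 2)"
proof -
  let ?R = "{z. poly p z = 0}"
  have "p \<noteq> 0" using monic by auto
  then have fin: "finite ?R" by (rule poly_roots_finite)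
  have refl1: "reflect_poly [:- z, 1:] = [:1, - z:]" for z :: complex
    by (simp add: reflect_poly_def)
  have "p = (\<Prod>z\<in>?R. [:- z, 1:] ^ order z p)"
    using complex_poly_decompose[of p] monic by simp
  then have "reflect_poly p = reflect_poly (\<Prod>z\<in>?R. [:- z, 1:] ^ order z p)"
    by simp
  also have "\<dots> = (\<Prod>z\<in>?R. [:1, - z:] ^ order z p)"
    by (simp only: reflect_poly_prod reflect_poly_power refl1)
  finally have eq: "(\<Prod>z\<in>?R. [:1, - z:] ^ order z p) = reflect_poly p" ..
  note low = low_coeffs_prod_linear[OF fin, of "\<lambda>z. order z p", unfolded eq]
  have "coeff (reflect_poly p) 1 = coeff p (degree p - 1)"
       "coeff (reflect_poly p) 2 = coeff p (degree p - 2)"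
    using deg by (simp_all add: coeff_reflect_poly)
  note low' = low[unfolded this]
  show "(\<Sum>z\<in>?R. of_nat (order z p) * z) = - coeff p (degree p - 1)"
    by (simp only: low' minus_minus)
  show "(\<Sum>z\<in>?R. of_nat (order z p) * z\<^sup>2)
         = (coeff p (degree p - 1))\<^sup>2 - 2 * coeff p (degree p - 2)"
    using low' by metis
qed

lemma sum_order_roots:
  fixes p :: "complex poly"
  assumes "p \<noteq> 0"
  shows "(\<Sum>z | poly p z = 0. order z p) = degree p"
proof -
  let ?q = "\<Prod>z | poly p z = 0. [:- z, 1:] ^ order z p"
  have "degree p = degree (smult (lead_coeff p) ?q)"
    by (simp only: complex_poly_decompose)
  also have "\<dots> = degree ?q"
    using assms by simp
  also have "\<dots> = (\<Sum>z | poly p z = 0. order z p)"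
    by (subst degree_prod_sum_eq) (auto simp: degree_power_eq)
  finally show ?thesis ..
qed

section \<open>Polynomials with three roots and the given power sums\<close>

text \<open>Cauchy--Schwarz for the values \<open>a\<close> and \<open>b\<close> repeated \<open>k\<close> and \<open>l\<close> times.\<close>
lemma weighted_sum_squared_le:
  fixes k l a b :: real
  assumes "k \<ge> 0" "l \<ge> 0"
  shows "(k * a + l * b)\<^sup>2 \<le> (k + l) * (k * a\<^sup>2 + l * b\<^sup>2)"
proof -
  have "(k + l) * (k * a\<^sup>2 + l * b\<^sup>2) - (k * a + l * b)\<^sup>2 = k * l * (a - b)\<^sup>2"
    by (simp add: power2_eq_square algebra_simps)
  moreover have "k * l * (a - b)\<^sup>2 \<ge> 0"
    using assms by simp
  ultimately show ?thesis by linarith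
qed

lemma rational_with_integer_power:
  fixes q :: real
  assumes "q \<in> \<rat>" "q ^ k \<in> \<int>" "k > 0"
  shows "q \<in> \<int>"
proof (rule rational_algebraic_int_is_int)
  show "algebraic_int q"
  proof (rule algebraic_int_root[where p = "monom 1 k"])
    show "algebraic_int (q ^ k)" by (rule int_imp_algebraic_int) fact
  qed (use assms in \<open>auto simp: poly_monom degree_monom_eq\<close>)
qed fact

lemma rational_root_of_monic_quadratic:
  fixes s :: real
  assumes "s \<in> \<rat>" "c \<in> \<int>" "d \<in> \<int>" "s\<^sup>2 + c * s + d = 0"
  shows "s \<in> \<int>"
proof (rule rational_algebraic_int_is_int)
  show "algebraic_int s"
  proof (rule algebraic_int.intros[where p = "[:d, c, 1:]"])
    show "\<forall>i. coeff [:d, c, 1:] i \<in> \<int>"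
      using assms by (auto simp: coeff_pCons split: nat.splits)
  qed (use assms in \<open>auto simp: power2_eq_square algebra_simps\<close>)
qed fact

text \<open>
  This lemma contains the whole algebraic part of the argument; what is special to graphs are its
  hypotheses on the power sums and on the multiplicity of the root 0.
\<close>
lemma three_roots_classification:
  fixes p :: "complex poly"
  assumes monic: "lead_coeff p = 1"
    and ints: "\<And>i. coeff p i \<in> \<int>"
    and sum1: "(\<Sum>z | poly p z = 0. of_nat (order z p) * z) = - of_nat (degree p)"
    and sum2: "(\<Sum>z | poly p z = 0. of_nat (order z p) * z\<^sup>2) = of_nat (degree p)"
    and zero: "poly p 0 = 0"
    and order0: "5 * order 0 p < 3 * degree p"
    and three: "card {z. poly p z = 0} = 3"
  shows "{z. poly p z = 0} \<subseteq>
    {0,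
     -2 + complex_of_real (sqrt 2) * \<i>,
     -2 - complex_of_real (sqrt 2) * \<i>,
     (-3 + complex_of_real (sqrt 3) * \<i>) / 2,
     (-3 - complex_of_real (sqrt 3) * \<i>) / 2}" (is "_ \<subseteq> ?Z")
proof -
  let ?R = "{z. poly p z = 0}"
  define n where "n = degree p"
  have p0: "p \<noteq> 0" using monic by auto
  have fin: "finite ?R" using p0 by (rule poly_roots_finite)
  have "card (?R - {0}) = 2"
    using three zero fin by (simp add: card_Diff_singleton)
  then obtain a b where ab: "?R - {0} = {a, b}" "a \<noteq> b"
    by (auto simp: card_2_iff)
  have R: "?R = {0, a, b}" using ab zero by auto
  have nz: "a \<noteq> 0" "b \<noteq> 0" using ab by auto
  define m k l where "m = order 0 p" and "k = order a p" and "l = order b p"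
  have pos: "m > 0" "k > 0" "l > 0"
    using R p0 by (auto simp: m_def k_def l_def order_gt_0_iff)
  have n_eq: "n = m + k + l"
    using sum_order_roots[OF p0] R nz ab(2) by (simp add: n_def m_def k_def l_def)
  have E1: "of_nat k * a + of_nat l * b = - of_nat n"
    using sum1 R nz ab(2) by (simp add: n_def k_def l_def)
  have E2: "of_nat k * a\<^sup>2 + of_nat l * b\<^sup>2 = of_nat n"
    using sum2 R nz ab(2) by (simp add: n_def k_def l_def)

  have not_real: "\<not> (Im a = 0 \<and> Im b = 0)"
  proof
    assume real: "Im a = 0 \<and> Im b = 0"
    have r1: "real k * Re a + real l * Re b = - real n"
      using arg_cong[OF E1, of Re] by simp
    have r2: "real k * (Re a)\<^sup>2 + real l * (Re b)\<^sup>2 = real n"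
      using arg_cong[OF E2, of Re] real by (simp add: power2_eq_square)
    have "real n * real n \<le> (real k + real l) * real n"
      using weighted_sum_squared_le[of "real k" "real l" "Re a" "Re b"] r1 r2
      by (simp add: power2_eq_square)
    then have "real n \<le> real k + real l"
      using n_eq pos by (simp add: mult_le_cancel_right)
    then show False using n_eq pos by simp
  qed
  have cnj_root: "cnj z \<in> ?R" if "z \<in> ?R" for z
  proof -
    have "coeff p i \<in> \<real>" for i
      using ints[of i] by (auto elim!: Ints_cases)
    then show ?thesis using that real_poly_cnj_root_iff[of p z] by simp
  qed
  have b: "b = cnj a"
  proof (cases "Im a = 0")
    case False
    have "cnj a \<in> {0, a, b}" using cnj_root[of a] R by blast
    moreover have "cnj a \<noteq> a" using False by (simp add: complex_eq_iff)
    ultimately show ?thesis using nz by auto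
  next
    case True
    then have "Im b \<noteq> 0" using not_real by simp
    have "cnj b \<in> {0, a, b}" using cnj_root[of b] R by blast
    moreover have "cnj b \<noteq> b" using \<open>Im b \<noteq> 0\<close> by (simp add: complex_eq_iff)
    ultimately show ?thesis using nz by auto
  qed
  have Ima: "Im a \<noteq> 0" using not_real b by auto
  have "k = l"
    using arg_cong[OF E1, of Im] b Ima by simp
  note l = this[symmetric]

  define s where "s = real n / real k"
  define q where "q = (Re a)\<^sup>2 + (Im a)\<^sup>2"
  have n_sk: "real n = s * real k" using pos by (simp add: s_def)
  have "real k * (2 * Re a) = real k * (- s)"
    using arg_cong[OF E1, of Re] b l n_sk by (simp add: algebra_simps)
  then have Rea: "Re a = - s / 2"
    using pos by (subst (asm) mult_cancel_left) auto
  have "real k * (2 * ((Re a)\<^sup>2 - (Im a)\<^sup>2)) = real k * s"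
    using arg_cong[OF E2, of Re] b l n_sk by (simp add: power2_eq_square algebra_simps)
  then have diff: "2 * ((Re a)\<^sup>2 - (Im a)\<^sup>2) = s"
    using pos by (subst (asm) mult_cancel_left) auto
  have Ima2: "(Im a)\<^sup>2 = s\<^sup>2 / 4 - s / 2"
    using diff unfolding Rea by (simp add: power_divide)
  have q_eq: "q = (s\<^sup>2 - s) / 2"
    unfolding q_def Ima2 Rea by (simp add: power_divide field_simps)

  \<comment> \<open>The lowest nonzero coefficient of \<open>p\<close> is a power of \<open>a * b = q\<close>.\<close>
  have "p = (\<Prod>z\<in>{0, a, b}. [:- z, 1:] ^ order z p)"
    using complex_poly_decompose[of p] monic R by simp
  also have "\<dots> = [:0, 1:] ^ m * ([:- a, 1:] ^ k * [:- b, 1:] ^ k)"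
    using nz ab(2) l by (simp add: m_def k_def l_def)
  also have "[:0, 1:] ^ m = (monom 1 m :: complex poly)"
    by (simp add: monom_altdef)
  finally have "coeff p m = coeff (monom 1 m * ([:- a, 1:] ^ k * [:- b, 1:] ^ k)) m"
    by (rule arg_cong)
  also have "\<dots> = (- a) ^ k * (- b) ^ k"
    by (simp add: coeff_monom_mult coeff_mult_0 coeff_0_power)
  also have "\<dots> = (a * cnj a) ^ k"
    by (simp add: power_mult_distrib[symmetric] b)
  also have "a * cnj a = of_real q"
    by (simp add: q_def complex_mult_cnj)
  finally have "complex_of_real (q ^ k) \<in> \<int>"
    using ints[of m] by simp
  then have "q ^ k \<in> \<int>"
    by (metis Ints_cases Ints_of_int of_real_eq_iff of_real_of_int_eq)
  moreover have s_rat: "s \<in> \<rat>" by (simp add: s_def)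
  ultimately have "q \<in> \<int>"
    using pos by (intro rational_with_integer_power[of q k]) (auto simp: q_eq)
  moreover have "s\<^sup>2 + (-1) * s + (- 2 * q) = 0" by (simp add: q_eq field_simps)
  ultimately have "s \<in> \<int>"
    using s_rat by (intro rational_root_of_monic_quadratic[of s "-1" "- 2 * q"]) auto
  then obtain t :: int where t: "s = of_int t" by (auto elim: Ints_cases)
  have "s > 2"
    using n_eq l pos by (simp add: s_def field_simps)
  have "s < 5"
    using order0 n_eq l pos unfolding s_def m_def[symmetric] n_def[symmetric]
    by (simp add: divide_less_eq)
  then have "s = 3 \<or> s = 4"
    using \<open>s > 2\<close> t by auto
  then have "a \<in> ?Z \<and> cnj a \<in> ?Z"
  proof
    assume s: "s = 3"
    have "(Im a)\<^sup>2 = (sqrt 3 / 2)\<^sup>2"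
      using Ima2 s by (simp add: power_divide)
    then have "Im a = sqrt 3 / 2 \<or> Im a = - (sqrt 3 / 2)"
      by (simp only: power2_eq_iff)
    then show ?thesis
      using Rea s by (auto simp: complex_eq_iff)
  next
    assume s: "s = 4"
    have "(Im a)\<^sup>2 = (sqrt 2)\<^sup>2"
      using Ima2 s by simp
    then have "Im a = sqrt 2 \<or> Im a = - sqrt 2"
      by (simp only: power2_eq_iff)
    then show ?thesis
      using Rea s by (auto simp: complex_eq_iff)
  qed
  then show ?thesis using R b by auto
qed

section \<open>Small transversals\<close>

text \<open>
  Choose greedily an element that lies in two of the sets and discard the sets that contain it:
  this costs 1 and lowers \<open>card V + 2 * card I\<close> by at least 5. Once no such element is left, the
  sets are disjoint, so that \<open>card V \<ge> 3 * card I\<close> and one element from each is cheap enough.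
\<close>
lemma small_transversal:
  assumes "finite I" "finite V" "\<And>i. i \<in> I \<Longrightarrow> F i \<subseteq> V \<and> card (F i) \<ge> 3"
  shows "\<exists>T \<subseteq> V. (\<forall>i\<in>I. F i \<inter> T \<noteq> {}) \<and> 5 * card T \<le> card V + 2 * card I"
  using assms
proof (induction "card I" arbitrary: I V rule: less_induct)
  case less
  note finI = less.prems(1) and finV = less.prems(2) and F = less.prems(3)
  show ?case
  proof (cases "\<exists>v\<in>V. card {i\<in>I. v \<in> F i} \<ge> 2")
    case True
    then obtain v where v: "v \<in> V" "card {i\<in>I. v \<in> F i} \<ge> 2" by blast
    define J where "J = {i\<in>I. v \<notin> F i}"
    have "I = J \<union> {i\<in>I. v \<in> F i}" "J \<inter> {i\<in>I. v \<in> F i} = {}"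
      by (auto simp: J_def)
    then have cardI: "card I = card J + card {i\<in>I. v \<in> F i}"
      using finI by (metis (no_types, lifting) card_Un_disjoint finite_Un)
    have finJ: "finite J" using finI by (simp add: J_def)
    have "\<exists>T \<subseteq> V - {v}. (\<forall>i\<in>J. F i \<inter> T \<noteq> {}) \<and> 5 * card T \<le> card (V - {v}) + 2 * card J"
    proof (rule less.hyps)
      show "card J < card I" using cardI v by simp
      show "F i \<subseteq> V - {v} \<and> card (F i) \<ge> 3" if "i \<in> J" for i
        using F[of i] that by (auto simp: J_def)
    qed (use finJ finV in auto)
    then obtain T where T: "T \<subseteq> V - {v}" "\<forall>i\<in>J. F i \<inter> T \<noteq> {}"
      "5 * card T \<le> card (V - {v}) + 2 * card J" by blast
    have finT: "finite T" using T(1) finV by (meson finite_Diff finite_subset)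
    have "card V > 0" using v finV by (auto simp: card_gt_0_iff)
    then have "5 * card (insert v T) \<le> card V + 2 * card I"
      using T finT v finV cardI by (subst card_insert_disjoint) (auto simp: card_Diff_singleton)
    moreover have "\<forall>i\<in>I. F i \<inter> insert v T \<noteq> {}"
      using T(2) by (auto simp: J_def)
    moreover have "insert v T \<subseteq> V" using T v by auto
    ultimately show ?thesis by blast
  next
    case False
    have disj: "F i \<inter> F j = {}" if "i \<in> I" "j \<in> I" "i \<noteq> j" for i j
    proof (rule ccontr)
      assume "F i \<inter> F j \<noteq> {}"
      then obtain v where v: "v \<in> F i" "v \<in> F j" by blast
      have "card {i, j} \<le> card {i\<in>I. v \<in> F i}"
        using that v finI by (intro card_mono) auto
      moreover have "v \<in> V" using F that v by blast
      ultimately show False using False that by auto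
    qed
    have finF: "finite (F i)" if "i \<in> I" for i
      using F[OF that] finV finite_subset by blast
    have "3 * card I \<le> (\<Sum>i\<in>I. card (F i))"
      using sum_bounded_below[of I 3 "\<lambda>i. card (F i)"] F by (simp add: mult.commute)
    also have "\<dots> = card (\<Union>i\<in>I. F i)"
      using finI finF disj by (intro card_UN_disjoint[symmetric]) auto
    also have "\<dots> \<le> card V"
      using F finV by (intro card_mono) auto
    finally have V: "3 * card I \<le> card V" .
    have ne: "F i \<noteq> {}" if "i \<in> I" for i
      using F[OF that] by auto
    define T where "T = (\<lambda>i. SOME v. v \<in> F i) ` I"
    have choice: "(SOME v. v \<in> F i) \<in> F i" if "i \<in> I" for i
      using ne[OF that] by (simp add: some_in_eq)
    have "card T \<le> card I" unfolding T_def using finI by (rule card_image_le)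
    then have "5 * card T \<le> card V + 2 * card I" using V by linarith
    moreover have "T \<subseteq> V" unfolding T_def using choice F by blast
    moreover have "\<forall>i\<in>I. F i \<inter> T \<noteq> {}" unfolding T_def using choice by blast
    ultimately show ?thesis by blast
  qed
qed

section \<open>Graphs of minimum degree at least three\<close>

lemma (in pair_graph) finite_neighbours: "finite {u. (v, u) \<in> parcs G}"
  by (rule finite_subset[OF _ pair_finite_verts]) (auto intro: in_arcsD2)

lemma (in pair_graph) card_neighbours_ge_min_degree:
  assumes "v \<in> pverts G"
  shows "card {u. (v, u) \<in> parcs G} \<ge> min_degree G"
proof -
  have "out_arcs (with_proj G) v = Pair v ` {u. (v, u) \<in> parcs G}"
    by (auto simp: out_arcs_def)
  then have "out_degree (with_proj G) v = card {u. (v, u) \<in> parcs G}"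
    by (simp add: out_degree_def card_image inj_on_def)
  then show ?thesis
    using assms pair_finite_verts unfolding min_degree_def by (metis Min_le finite_imageI image_eqI)
qed

lemma (in pair_graph) arc_sym: "(u, v) \<in> parcs G \<longleftrightarrow> (v, u) \<in> parcs G"
  using pair_sym_arcs by (auto simp: symmetric_def dest: symD)

text \<open>
  Applied directly to the \<open>n\<close> open neighbourhoods, the transversal bound gives \<open>5 * card D \<le> 3 * n\<close>.
  It becomes strict because every vertex lies in at least three open neighbourhoods: putting any
  vertex into the set first leaves \<open>n - 1\<close> vertices and at most \<open>n - 3\<close> neighbourhoods, so that
  \<open>n + 2 * n\<close> drops by 7 at the price of 5. Strictness matters, since equality would allow
  \<open>s = 5\<close> in \<open>three_roots_classification\<close>.
\<close>
lemma (in pair_graph) small_total_dominating_set: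
  assumes deg: "min_degree G \<ge> 3" and ne: "pverts G \<noteq> {}"
  shows "\<exists>D. total_dominating_set G D \<and> 5 * card D < 3 * card (pverts G)"
proof -
  let ?V = "pverts G"
  define N where "N v = {u. (v, u) \<in> parcs G}" for v
  have N: "N v \<subseteq> ?V" "card (N v) \<ge> 3" if "v \<in> ?V" for v
    using card_neighbours_ge_min_degree[OF that] deg by (auto simp: N_def intro: in_arcsD2)
  obtain w where w: "w \<in> ?V" using ne by blast
  define J where "J = ?V - N w"
  have cardJ: "card J + 3 \<le> card ?V"
    using N[OF w] pair_finite_verts card_mono[OF pair_finite_verts N(1)[OF w]]
    by (simp add: J_def card_Diff_subset finite_subset)
  have "\<exists>T \<subseteq> ?V - {w}. (\<forall>v\<in>J. N v \<inter> T \<noteq> {}) \<and> 5 * card T \<le> card (?V - {w}) + 2 * card J"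
  proof (rule small_transversal)
    show "N v \<subseteq> ?V - {w} \<and> card (N v) \<ge> 3" if "v \<in> J" for v
      using N[of v] that arc_sym[of v w] by (auto simp: J_def N_def)
  qed (auto simp: J_def pair_finite_verts)
  then obtain T where T: "T \<subseteq> ?V - {w}" "\<forall>v\<in>J. N v \<inter> T \<noteq> {}"
    "5 * card T \<le> card (?V - {w}) + 2 * card J" by blast
  have "total_dominating_set G (insert w T)"
    using T w arc_sym[of w] unfolding total_dominating_set_def J_def N_def by fastforce
  moreover have "card (insert w T) \<le> card T + 1"
    by (simp add: card_insert_le_m1 card_insert_if finite_subset[OF T(1)] pair_finite_verts)
  then have "5 * card (insert w T) < 3 * card ?V"
    using T(3) cardJ w pair_finite_verts by (simp add: card_Diff_singleton)
  ultimately show ?thesis by blast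
qed

lemma (in pair_graph) coeff_total_domination_poly:
  assumes "pverts G \<noteq> {}"
  shows "coeff (total_domination_poly G) i = of_nat (num_total_dominating_sets G i)"
proof -
  have D: "finite D \<and> D \<noteq> {} \<and> card D \<le> card (pverts G)" if "total_dominating_set G D" for D
    using that assms pair_finite_verts
    by (auto simp: total_dominating_set_def intro: finite_subset card_mono)
  have "num_total_dominating_sets G i = 0" if "i \<notin> {1..card (pverts G)}"
  proof -
    have "{D. total_dominating_set G D \<and> card D = i} = {}"
      using D that by (fastforce simp: card_gt_0_iff Suc_le_eq)
    then show ?thesis by (simp only: num_total_dominating_sets_def card.empty)
  qed
  then show ?thesis
    by (auto simp: total_domination_poly_def coeff_sum)
qed

text \<open>
  A set that misses fewer than \<open>\<delta>\<close> vertices cannot miss a whole open neighbourhood.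
\<close>
lemma (in pair_graph) num_large_total_dominating_sets:
  assumes "i < min_degree G" "i \<le> card (pverts G)"
  shows "num_total_dominating_sets G (card (pverts G) - i) = card (pverts G) choose i"
proof -
  let ?V = "pverts G"
  have "total_dominating_set G D" if D: "D \<subseteq> ?V" "card D = card ?V - i" for D
    unfolding total_dominating_set_def
  proof (intro conjI ballI)
    fix v assume v: "v \<in> ?V"
    have "card (?V - D) = i"
      using D assms pair_finite_verts by (simp add: card_Diff_subset finite_subset)
    then have "\<not> {u. (v, u) \<in> parcs G} \<subseteq> ?V - D"
      using card_neighbours_ge_min_degree[OF v] assms pair_finite_verts
        card_mono[of "?V - D" "{u. (v, u) \<in> parcs G}"] by auto
    then show "\<exists>u\<in>D. (v, u) \<in> parcs G"
      using in_arcsD2 by auto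
  qed (use D in simp)
  then have "{D. total_dominating_set G D \<and> card D = card ?V - i}
      = {D. D \<subseteq> ?V \<and> card D = card ?V - i}"
    by (auto simp: total_dominating_set_def)
  then show ?thesis
    using assms pair_finite_verts
    by (simp add: num_total_dominating_sets_def n_subsets binomial_symmetric[symmetric])
qed

lemma (in pair_graph) order_0_total_domination_poly_le:
  assumes "total_dominating_set G D" "pverts G \<noteq> {}"
  shows "order 0 (total_domination_poly G) \<le> card D"
proof (rule ccontr)
  let ?P = "total_domination_poly G"
  assume "\<not> ?thesis"
  then have "coeff ?P (card D) = 0"
    using monom_1_dvd_iff'[of "order 0 ?P" ?P] order_1[of 0 ?P] by (simp add: monom_altdef)
  then have "num_total_dominating_sets G (card D) = 0"
    by (simp add: coeff_total_domination_poly[OF assms(2)])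
  moreover have "finite {E. total_dominating_set G E \<and> card E = card D}"
    by (rule finite_subset[of _ "Pow (pverts G)"])
      (auto simp: total_dominating_set_def pair_finite_verts)
  ultimately show False
    using assms(1) unfolding num_total_dominating_sets_def by auto
qed

theorem theorem2p4:
  fixes G :: "'a pair_pre_digraph"
  assumes "pair_graph G"
    and "min_degree G \<ge> 3"
    and "card (complex_roots (total_domination_poly G)) = 3"
  shows "complex_roots (total_domination_poly G) \<subseteq>
    {0,
     -2 + complex_of_real (sqrt 2) * \<i>,
     -2 - complex_of_real (sqrt 2) * \<i>,
     (-3 + complex_of_real (sqrt 3) * \<i>) / 2,
     (-3 - complex_of_real (sqrt 3) * \<i>) / 2}"
proof -
  interpret pair_graph G by fact
  let ?V = "pverts G" and ?P = "total_domination_poly G"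
  define n where "n = card ?V"
  \<comment> \<open>Without vertices the polynomial is 0, and \<^const>\<open>card\<close> is 0 on its infinite set of roots.\<close>
  have ne: "?V \<noteq> {}"
  proof
    assume "?V = {}"
    then have "?P = 0" by (simp add: total_domination_poly_def)
    then show False
      using assms(3) by (simp add: complex_roots_def infinite_UNIV_char_0)
  qed
  then obtain w where w: "w \<in> ?V" by blast
  have "card {u. (w, u) \<in> parcs G} \<le> n"
    unfolding n_def by (rule card_mono[OF pair_finite_verts]) (auto intro: in_arcsD2)
  then have n3: "n \<ge> 3"
    using card_neighbours_ge_min_degree[OF w] assms(2) by linarith
  have top: "coeff ?P (n - i) = of_nat (n choose i)" if "i \<le> 2" for i
    using num_large_total_dominating_sets[of i] that assms(2) n3
    by (simp add: coeff_total_domination_poly[OF ne] n_def)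
  have deg: "degree ?P = n"
  proof (rule antisym)
    show "degree ?P \<le> n"
      unfolding total_domination_poly_def n_def
      by (intro degree_sum_le) (auto intro: order_trans[OF degree_monom_le])
    show "n \<le> degree ?P"
      using top[of 0] by (intro le_degree) simp
  qed
  have monic: "lead_coeff ?P = 1"
    using top[of 0] by (simp add: deg)
  have binom2: "2 * complex_of_nat (n choose 2) = of_nat n * of_nat n - of_nat n"
  proof -
    have "2 * (n choose 2) + n = n * n"
      using n3 by (cases n) (auto simp: choose_two)
    then show ?thesis
      by (metis add_diff_cancel_right' of_nat_add of_nat_mult of_nat_numeral)
  qed
  have roots: "(\<Sum>z | poly ?P z = 0. of_nat (order z ?P) * z) = - of_nat (degree ?P)"
    "(\<Sum>z | poly ?P z = 0. of_nat (order z ?P) * z\<^sup>2) = of_nat (degree ?P)"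
    using root_power_sums[OF monic] n3 top[of 1] top[of 2] binom2
    by (simp_all add: deg power2_eq_square)
  have zero: "poly ?P 0 = 0"
    by (simp add: total_domination_poly_def poly_sum poly_monom)
  obtain D where D: "total_dominating_set G D" "5 * card D < 3 * n"
    using small_total_dominating_set[OF assms(2) ne] by (auto simp: n_def)
  have order0: "5 * order 0 ?P < 3 * degree ?P"
    using order_0_total_domination_poly_le[OF D(1) ne] D(2) deg by linarith
  have ints: "coeff ?P i \<in> \<int>" for i
    by (simp add: coeff_total_domination_poly[OF ne])
  show ?thesis
    using three_roots_classification[OF monic ints roots zero order0] assms(3)
    by (simp add: complex_roots_def)
qed

end
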